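(* Consider the multistage stochastic AC optimal power flow setting, the problems $(P)$, $(P_{\mathrm{SOC}})$, and the family $(\bar v^{\mathrm{Lin}},\bar S^{\mathrm{Lin}})$ described in the context. Assume: 1. the network is radial and connected; 2. the network is passive, i.e. $\Re(z_{i,j})\ge 0$ and $\Im(z_{i,j})\ge 0$ for all lines $(i,j)\in\mathcal E$; 3. the cost function $C$ is convex, component-wise monotone non-increasing in $\Re(S)$, $\Im(S)$ and $v$, and component-wise monotone non-decreasing in $\mathcal I$, $\Re(s_0)$, $\Im(s_0)$ and $|S|$; 4. $\bar v^{\mathrm{Lin}}_{i,t,\omega}\le\overline v_i$ for all $i\in\mathcal B$, $t\in\mathcal T$, $\omega\in\Omega$, and $\Re(z_{k,l}^*\bar S^{\mathrm{Lin}}_{(i,j),t,\omega})\le0$ for all $(i,j)\in\mathcal E$, $(k,l)\in\mathcal E_i$, $t\in\mathcal T$, $\omega\in\Omega$. Then $(P)$ has no relaxation gap, i.e. $val(P)=val(P_{\mathrm{SOC}})$.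
   Context: Network. $\mathcal B=\{0,1,\dots,n\}$ is the set of buses, bus $0$ being the slack (reference) bus. $\mathcal E$ is the set of edges. The network is radial and connected: it is a tree, rooted at $0$, with every edge directed towards the root, so for each $i\in\mathcal B\setminus\{0\}$ there is exactly one edge $(i,j)\in\mathcal E$ leaving $i$ ($j$ is the parent of $i$). Edge $(i,j)$ has impedance $z_{i,j}\in\mathbb C$. For a bus $i$, $\mathcal E_i$ is the set of edges of the sub-tree starting from $i$, i.e. edges $(k,l)\in\mathcal E$ with both endpoints among $i$ and its descendants (so the edge from $i$ to its parent is not in $\mathcal E_i$). $z^*$ is the complex conjugate, $\mathbf i^2=-1$. Time and scenarios. $\mathcal T=\{0,1,\dots,T\}$; step $t$ has duration $\Delta_t>0$. $\Omega$ is a finite set of scenarios with given probabilities, and $\mathbb E$ is the corresponding expectation. Each $\omega\in\Omega$ carries an exogenous trajectory $(\xi_{t,\omega})_{t\in\mathcal T}$; $\omega,\omega'$ are indistinguishable up to time $t$ if $\xi_{\tau,\omega}=\xi_{\tau,\omega'}$ for all $\tau\le t$. A family $y=(y_{t,\omega})$ is non-anticipative if $y_{t,\omega}=y_{t,\omega'}$ for all $t$ and all $\omega,\omega'$ indistinguishable up to time $t$. Data. Real bounds $\underline v_i,\overline v_i$ (with $\underline v_i>0$), $\overline{\mathcal I}_{(i,j)}$, $\overline S_{(i,j)}$, $\overline p^{\mathrm{inj}}_i$, $\overline p^{\mathrm{abs}}_i$, $\underline q_i,\overline q_i$, $\underline X_i,\overline X_i$; real efficiencies $\rho^{\mathrm{abs}}_i,\rho^{\mathrm{inj}}_i$;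 initial states of charge $x_i$; complex exogenous demands $s^d_{i,t,\omega}$. Variables. $y=(s_0,s,p^{\mathrm{inj}},p^{\mathrm{abs}},q,X,S,\mathcal I,v)$, where $s_{0,t,\omega}\in\mathbb C$; for $i\in\mathcal B\setminus\{0\}$, $s_{i,t,\omega}\in\mathbb C$ and $p^{\mathrm{inj}}_{i,t,\omega},p^{\mathrm{abs}}_{i,t,\omega},q_{i,t,\omega},X_{i,t,\omega}\in\mathbb R$; for $(i,j)\in\mathcal E$, $S_{(i,j),t,\omega}\in\mathbb C$ and $\mathcal I_{(i,j),t,\omega}\in\mathbb R$; for $i\in\mathcal B$, $v_{i,t,\omega}\in\mathbb R$. Base constraints, for all $t\in\mathcal T$, $\omega\in\Omega$: (a) $v_{0,t,\omega}=1$, and $\underline v_i\le v_{i,t,\omega}\le\overline v_i$ for $i\ne0$; (b) $0\le\mathcal I_{(i,j),t,\omega}\le\overline{\mathcal I}_{(i,j)}$ and $|S_{(i,j),t,\omega}|\le\overline S_{(i,j)}$ for $(i,j)\in\mathcal E$; (c) $0\le p^{\mathrm{inj}}_{i,t,\omega}\le\overline p^{\mathrm{inj}}_i$, $0\le p^{\mathrm{abs}}_{i,t,\omega}\le\overline p^{\mathrm{abs}}_i$, $\underline q_i\le q_{i,t,\omega}\le\overline q_i$ for $i\ne0$; (d) for $i\ne 0$: $X_{i,t+1,\omega}=X_{i,t,\omega}+\rho^{\mathrm{abs}}_i p^{\mathrm{abs}}_{i,t,\omega}\Delta_t-\rho^{\mathrm{inj}}_i p^{\mathrm{inj}}_{i,t,\omega}\Delta_t$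 if $t<T$; $X_{i,0,\omega}=x_i$; $\underline X_i\le X_{i,t,\omega}\le\overline X_i$; (e) $s_{i,t,\omega}=p^{\mathrm{inj}}_{i,t,\omega}-p^{\mathrm{abs}}_{i,t,\omega}+\mathbf i q_{i,t,\omega}-s^d_{i,t,\omega}$ for $i\ne0$; (f) $S_{(i,j),t,\omega}=\sum_{(k,i)\in\mathcal E}(S_{(k,i),t,\omega}-z_{k,i}\mathcal I_{(k,i),t,\omega})+s_{i,t,\omega}$ for $(i,j)\in\mathcal E$, and $0=\sum_{(k,0)\in\mathcal E}(S_{(k,0),t,\omega}-z_{k,0}\mathcal I_{(k,0),t,\omega})+s_{0,t,\omega}$; (g) $v_{i,t,\omega}-v_{j,t,\omega}=2\Re(z_{i,j}^*S_{(i,j),t,\omega})-|z_{i,j}|^2\mathcal I_{(i,j),t,\omega}$ for $(i,j)\in\mathcal E$; (h) $y$ is non-anticipative. Non-convex constraint (NC): $v_{i,t,\omega}\mathcal I_{(i,j),t,\omega}=|S_{(i,j),t,\omega}|^2$ for all $(i,j)\in\mathcal E,t,\omega$. Relaxed constraint (SOC): $v_{i,t,\omega}\mathcal I_{(i,j),t,\omega}\ge|S_{(i,j),t,\omega}|^2$ for all $(i,j)\in\mathcal E,t,\omega$. Upper-bound linearized flow. Put $\overline s_{i,t,\omega}=\overline p^{\mathrm{inj}}_i+\mathbf i\,\overline q_i-s^d_{i,t,\omega}$ for $i\in\mathcal B\setminus\{0\}$. The real numbers $\bar v^{\mathrm{Lin}}_{i,t,\omega}$ ($i\in\mathcal B$)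 and complex numbers $\bar S^{\mathrm{Lin}}_{(i,j),t,\omega}$ ($(i,j)\in\mathcal E$) are the unique solution of $\bar S^{\mathrm{Lin}}_{(i,j),t,\omega}=\sum_{(k,i)\in\mathcal E}\bar S^{\mathrm{Lin}}_{(k,i),t,\omega}+\overline s_{i,t,\omega}$ for $(i,j)\in\mathcal E$; $\bar v^{\mathrm{Lin}}_{0,t,\omega}=1$; $\bar v^{\mathrm{Lin}}_{i,t,\omega}-\bar v^{\mathrm{Lin}}_{j,t,\omega}=2\Re(z_{i,j}^*\bar S^{\mathrm{Lin}}_{(i,j),t,\omega})$ for $(i,j)\in\mathcal E$ (for all $t,\omega$). Cost. $C$ is a real-valued convex function of the decision variables $(s_0,p^{\mathrm{inj}},p^{\mathrm{abs}},q,X,S,\mathcal I,v)$ of a scenario; it may depend on $\omega$ (in a progressively measurable way, i.e. adapted to the information $\xi$ revealed over time). The monotonicity assumption on $C$ is understood by regarding $C$ as a function of $(s_0,p^{\mathrm{inj}},p^{\mathrm{abs}},q,X,\mathcal I,v)$ and of $\Re(S)$, $\Im(S)$, $|S|$ (the families of real parts, imaginary parts and moduli of the line flows) as separate arguments, and requiring monotonicity in each component of each listed argument. Problems. $(P)$: minimize $\mathbb E[C]$ over $y$ subject to (a)–(h) and (NC). $(P_{\mathrm{SOC}})$: minimize $\mathbb E[C]$ over $y$ subject to (a)–(h) and (SOC). $val(\cdot)\in[-\infty,+\infty]$ is the infimum ($+\infty$ if infeasible). *)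

theory Defs
  imports "HOL-Analysis.Analysis" "HOL-Library.Function_Algebras"
begin

text \<open>Pointwise real vector space structure on functions, so that \<^const>\<open>convex_on\<close> applies to
  tuples of families of decision variables.\<close>

instantiation "fun" :: (type, real_vector) real_vector
begin

definition scaleR_fun :: "real \<Rightarrow> ('a \<Rightarrow> 'b) \<Rightarrow> 'a \<Rightarrow> 'b"
  where "scaleR_fun r f = (\<lambda>x. r *\<^sub>R f x)"

instance
  by standard (simp_all add: scaleR_fun_def fun_eq_iff scaleR_add_right scaleR_add_left)

end

type_synonym bus = nat
type_synonym edge = "nat \<times> nat"

text \<open>Buses are \<open>{0..nbus}\<close> with slack bus 0, time steps are \<open>{0..horizon}\<close>. An edge \<open>(i, j)\<close> goes
  from \<open>i\<close> to its parent \<open>j\<close>. Families are total functions; only their values on the index sets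
  below matter.\<close>

record ('w, 'x) opf =
  nbus :: nat
  edges :: "edge set"
  impedance :: "edge \<Rightarrow> complex"
  horizon :: nat
  duration :: "nat \<Rightarrow> real"
  scenarios :: "'w set"
  weight :: "'w \<Rightarrow> real"
  exo :: "nat \<Rightarrow> 'w \<Rightarrow> 'x"
  v_min :: "bus \<Rightarrow> real"
  v_max :: "bus \<Rightarrow> real"
  cur_max :: "edge \<Rightarrow> real"
  flow_max :: "edge \<Rightarrow> real"
  pinj_max :: "bus \<Rightarrow> real"
  pabs_max :: "bus \<Rightarrow> real"
  q_min :: "bus \<Rightarrow> real"
  q_max :: "bus \<Rightarrow> real"
  X_min :: "bus \<Rightarrow> real"
  X_max :: "bus \<Rightarrow> real"
  eff_abs :: "bus \<Rightarrow> real"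
  eff_inj :: "bus \<Rightarrow> real"
  X_init :: "bus \<Rightarrow> real"
  demand :: "bus \<Rightarrow> nat \<Rightarrow> 'w \<Rightarrow> complex"

definition buses :: "('w, 'x) opf \<Rightarrow> bus set"
  where "buses D = {0..nbus D}"

definition steps :: "('w, 'x) opf \<Rightarrow> nat set"
  where "steps D = {0..horizon D}"

definition opf_data :: "('w, 'x) opf \<Rightarrow> bool"
  where "opf_data D \<longleftrightarrow>
    finite (scenarios D) \<and> (\<forall>\<omega>\<in>scenarios D. 0 \<le> weight D \<omega>) \<and> (\<Sum>\<omega>\<in>scenarios D. weight D \<omega>) = 1 \<and>
    (\<forall>t\<in>steps D. 0 < duration D t) \<and>
    (\<forall>i\<in>buses D - {0}. 0 < v_min D i)"

text \<open>A tree rooted at 0 with all edges directed towards the root.\<close>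

definition radial_connected :: "('w, 'x) opf \<Rightarrow> bool"
  where "radial_connected D \<longleftrightarrow>
    edges D \<subseteq> buses D \<times> buses D \<and>
    (\<forall>j. (0, j) \<notin> edges D) \<and>
    (\<forall>i\<in>buses D - {0}. \<exists>!j. (i, j) \<in> edges D) \<and>
    (\<forall>i\<in>buses D. (i, 0) \<in> (edges D)\<^sup>*)"

definition passive_network :: "('w, 'x) opf \<Rightarrow> bool"
  where "passive_network D \<longleftrightarrow> (\<forall>e\<in>edges D. 0 \<le> Re (impedance D e) \<and> 0 \<le> Im (impedance D e))"

definition subtree_edges :: "('w, 'x) opf \<Rightarrow> bus \<Rightarrow> edge set"
  where "subtree_edges D i =
    {(k, l). (k, l) \<in> edges D \<and> (k, i) \<in> (edges D)\<^sup>* \<and> (l, i) \<in> (edges D)\<^sup>*}"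

definition indistinguishable :: "('w, 'x) opf \<Rightarrow> nat \<Rightarrow> 'w \<Rightarrow> 'w \<Rightarrow> bool"
  where "indistinguishable D t \<omega> \<omega>' \<longleftrightarrow> (\<forall>\<tau>\<le>t. exo D \<tau> \<omega> = exo D \<tau> \<omega>')"

text \<open>\<open>s0 t \<omega>\<close>, and \<open>f a t \<omega>\<close> for the families indexed by a bus or an edge \<open>a\<close>.
  \<open>cur\<close> and \<open>vsq\<close> are the variables entering linearly (\<open>\<I>\<close> and \<open>v\<close>, i.e. squared magnitudes).\<close>

record 'w opf_vars =
  s0 :: "nat \<Rightarrow> 'w \<Rightarrow> complex"
  sinj :: "bus \<Rightarrow> nat \<Rightarrow> 'w \<Rightarrow> complex"
  pinj :: "bus \<Rightarrow> nat \<Rightarrow> 'w \<Rightarrow> real"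
  pabs :: "bus \<Rightarrow> nat \<Rightarrow> 'w \<Rightarrow> real"
  qinj :: "bus \<Rightarrow> nat \<Rightarrow> 'w \<Rightarrow> real"
  soc :: "bus \<Rightarrow> nat \<Rightarrow> 'w \<Rightarrow> real"
  flow :: "edge \<Rightarrow> nat \<Rightarrow> 'w \<Rightarrow> complex"
  cur :: "edge \<Rightarrow> nat \<Rightarrow> 'w \<Rightarrow> real"
  vsq :: "bus \<Rightarrow> nat \<Rightarrow> 'w \<Rightarrow> real"

definition nonanticipative :: "('w, 'x) opf \<Rightarrow> 'w opf_vars \<Rightarrow> bool"
  where "nonanticipative D y \<longleftrightarrow>
    (\<forall>t\<in>steps D. \<forall>\<omega>\<in>scenarios D. \<forall>\<omega>'\<in>scenarios D. indistinguishable D t \<omega> \<omega>' \<longrightarrow>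
      s0 y t \<omega> = s0 y t \<omega>' \<and>
      (\<forall>i\<in>buses D - {0}.
        sinj y i t \<omega> = sinj y i t \<omega>' \<and>
        pinj y i t \<omega> = pinj y i t \<omega>' \<and>
        pabs y i t \<omega> = pabs y i t \<omega>' \<and>
        qinj y i t \<omega> = qinj y i t \<omega>' \<and>
        soc y i t \<omega> = soc y i t \<omega>') \<and>
      (\<forall>e\<in>edges D. flow y e t \<omega> = flow y e t \<omega>' \<and> cur y e t \<omega> = cur y e t \<omega>') \<and>
      (\<forall>i\<in>buses D. vsq y i t \<omega> = vsq y i t \<omega>'))"

definition bound_constraints :: "('w, 'x) opf \<Rightarrow> 'w opf_vars \<Rightarrow> nat \<Rightarrow> 'w \<Rightarrow> bool"
  where "bound_constraints D y t \<omega> \<longleftrightarrow>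
    vsq y 0 t \<omega> = 1 \<and>
    (\<forall>i\<in>buses D - {0}. v_min D i \<le> vsq y i t \<omega> \<and> vsq y i t \<omega> \<le> v_max D i) \<and>
    (\<forall>e\<in>edges D. 0 \<le> cur y e t \<omega> \<and> cur y e t \<omega> \<le> cur_max D e \<and> cmod (flow y e t \<omega>) \<le> flow_max D e) \<and>
    (\<forall>i\<in>buses D - {0}.
      0 \<le> pinj y i t \<omega> \<and> pinj y i t \<omega> \<le> pinj_max D i \<and>
      0 \<le> pabs y i t \<omega> \<and> pabs y i t \<omega> \<le> pabs_max D i \<and>
      q_min D i \<le> qinj y i t \<omega> \<and> qinj y i t \<omega> \<le> q_max D i)"

definition storage_constraints :: "('w, 'x) opf \<Rightarrow> 'w opf_vars \<Rightarrow> nat \<Rightarrow> 'w \<Rightarrow> bool"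
  where "storage_constraints D y t \<omega> \<longleftrightarrow>
    (\<forall>i\<in>buses D - {0}.
      (t < horizon D \<longrightarrow> soc y i (t + 1) \<omega> =
         soc y i t \<omega> + eff_abs D i * pabs y i t \<omega> * duration D t - eff_inj D i * pinj y i t \<omega> * duration D t) \<and>
      soc y i 0 \<omega> = X_init D i \<and>
      X_min D i \<le> soc y i t \<omega> \<and> soc y i t \<omega> \<le> X_max D i)"

definition flow_constraints :: "('w, 'x) opf \<Rightarrow> 'w opf_vars \<Rightarrow> nat \<Rightarrow> 'w \<Rightarrow> bool"
  where "flow_constraints D y t \<omega> \<longleftrightarrow>
    (\<forall>i\<in>buses D - {0}. sinj y i t \<omega> =
       complex_of_real (pinj y i t \<omega>) - complex_of_real (pabs y i t \<omega>)
       + \<i> * complex_of_real (qinj y i t \<omega>) - demand D i t \<omega>) \<and>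
    (\<forall>(i, j)\<in>edges D. flow y (i, j) t \<omega> =
       (\<Sum>k | (k, i) \<in> edges D.
          flow y (k, i) t \<omega> - impedance D (k, i) * complex_of_real (cur y (k, i) t \<omega>)) + sinj y i t \<omega>) \<and>
    0 = (\<Sum>k | (k, 0) \<in> edges D.
          flow y (k, 0) t \<omega> - impedance D (k, 0) * complex_of_real (cur y (k, 0) t \<omega>)) + s0 y t \<omega> \<and>
    (\<forall>(i, j)\<in>edges D. vsq y i t \<omega> - vsq y j t \<omega> =
       2 * Re (cnj (impedance D (i, j)) * flow y (i, j) t \<omega>)
       - (cmod (impedance D (i, j)))\<^sup>2 * cur y (i, j) t \<omega>)"

definition base_feasible :: "('w, 'x) opf \<Rightarrow> 'w opf_vars \<Rightarrow> bool"
  where "base_feasible D y \<longleftrightarrow>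
    (\<forall>t\<in>steps D. \<forall>\<omega>\<in>scenarios D.
      bound_constraints D y t \<omega> \<and> storage_constraints D y t \<omega> \<and> flow_constraints D y t \<omega>) \<and>
    nonanticipative D y"

definition nonconvex_constraint :: "('w, 'x) opf \<Rightarrow> 'w opf_vars \<Rightarrow> bool"
  where "nonconvex_constraint D y \<longleftrightarrow>
    (\<forall>(i, j)\<in>edges D. \<forall>t\<in>steps D. \<forall>\<omega>\<in>scenarios D.
      vsq y i t \<omega> * cur y (i, j) t \<omega> = (cmod (flow y (i, j) t \<omega>))\<^sup>2)"

definition soc_constraint :: "('w, 'x) opf \<Rightarrow> 'w opf_vars \<Rightarrow> bool"
  where "soc_constraint D y \<longleftrightarrow>
    (\<forall>(i, j)\<in>edges D. \<forall>t\<in>steps D. \<forall>\<omega>\<in>scenarios D.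
      vsq y i t \<omega> * cur y (i, j) t \<omega> \<ge> (cmod (flow y (i, j) t \<omega>))\<^sup>2)"

text \<open>The decision variables \<open>(s0, pinj, pabs, q, X, S, \<I>, v)\<close> of one scenario.\<close>

type_synonym decision =
  "(nat \<Rightarrow> complex) \<times> (bus \<Rightarrow> nat \<Rightarrow> real) \<times> (bus \<Rightarrow> nat \<Rightarrow> real) \<times> (bus \<Rightarrow> nat \<Rightarrow> real) \<times>
   (bus \<Rightarrow> nat \<Rightarrow> real) \<times> (edge \<Rightarrow> nat \<Rightarrow> complex) \<times> (edge \<Rightarrow> nat \<Rightarrow> real) \<times> (bus \<Rightarrow> nat \<Rightarrow> real)"

definition decision_of :: "'w opf_vars \<Rightarrow> 'w \<Rightarrow> decision"
  where "decision_of y \<omega> =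
    ((\<lambda>t. s0 y t \<omega>), (\<lambda>i t. pinj y i t \<omega>), (\<lambda>i t. pabs y i t \<omega>), (\<lambda>i t. qinj y i t \<omega>),
     (\<lambda>i t. soc y i t \<omega>), (\<lambda>e t. flow y e t \<omega>), (\<lambda>e t. cur y e t \<omega>), (\<lambda>i t. vsq y i t \<omega>))"

fun same_decision :: "('w, 'x) opf \<Rightarrow> decision \<Rightarrow> decision \<Rightarrow> bool"
  where "same_decision D (a, pj, pa, q, X, S, c, v) (a', pj', pa', q', X', S', c', v') \<longleftrightarrow>
    (\<forall>t\<in>steps D.
      a t = a' t \<and>
      (\<forall>i\<in>buses D - {0}. pj i t = pj' i t \<and> pa i t = pa' i t \<and> q i t = q' i t \<and> X i t = X' i t) \<and>
      (\<forall>e\<in>edges D. S e t = S' e t \<and> c e t = c' e t) \<and>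
      (\<forall>i\<in>buses D. v i t = v' i t))"

text \<open>The cost is a function of the finitely many actual decision variables, i.e. it ignores the
  values of the total functions outside the index sets.\<close>

definition cost_of_decisions :: "('w, 'x) opf \<Rightarrow> ('w \<Rightarrow> decision \<Rightarrow> real) \<Rightarrow> bool"
  where "cost_of_decisions D C \<longleftrightarrow>
    (\<forall>\<omega>\<in>scenarios D. \<forall>d d'. same_decision D d d' \<longrightarrow> C \<omega> d = C \<omega> d')"

text \<open>Progressive measurability of the total cost over the horizon: if it is a sum of stage costs,
  each depending on the decisions up to \<open>t\<close> and, through \<open>exo\<close> up to \<open>t\<close> only, on the
  scenario, then it depends on the scenario only through the whole exogenous trajectory. Conversely
  a cost with the latter property is such a sum, with a single stage cost at the horizon.\<close>

definition adapted_cost :: "('w, 'x) opf \<Rightarrow> ('w \<Rightarrow> decision \<Rightarrow> real) \<Rightarrow> bool"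
  where "adapted_cost D C \<longleftrightarrow>
    (\<forall>\<omega>\<in>scenarios D. \<forall>\<omega>'\<in>scenarios D. indistinguishable D (horizon D) \<omega> \<omega>' \<longrightarrow> C \<omega> = C \<omega>')"

definition convex_cost :: "('w, 'x) opf \<Rightarrow> ('w \<Rightarrow> decision \<Rightarrow> real) \<Rightarrow> bool"
  where "convex_cost D C \<longleftrightarrow> (\<forall>\<omega>\<in>scenarios D. convex_on UNIV (C \<omega>))"

definition upd2 :: "('a \<Rightarrow> nat \<Rightarrow> 'b) \<Rightarrow> 'a \<Rightarrow> nat \<Rightarrow> 'b \<Rightarrow> ('a \<Rightarrow> nat \<Rightarrow> 'b)"
  where "upd2 f a t r = f(a := (f a)(t := r))"

text \<open>\<open>F\<close> is the cost of a scenario as a function of \<open>(s0, pinj, pabs, q, X, Re S, Im S, |S|, \<I>, v)\<close>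
  with the real parts, imaginary parts and moduli of the line flows as separate arguments;
  monotonicity is required in each single real component of the listed arguments.\<close>

definition monotone_cost :: "('w, 'x) opf \<Rightarrow> ('w \<Rightarrow> decision \<Rightarrow> real) \<Rightarrow> bool"
  where "monotone_cost D C \<longleftrightarrow> (\<forall>\<omega>\<in>scenarios D. \<exists>F.
    (\<forall>a pj pa q X S c v. C \<omega> (a, pj, pa, q, X, S, c, v) =
       F a pj pa q X (\<lambda>e t. Re (S e t)) (\<lambda>e t. Im (S e t)) (\<lambda>e t. cmod (S e t)) c v) \<and>
    (\<forall>a pj pa q X re im m c v. \<forall>t\<in>steps D.
       mono (\<lambda>r. F (a(t := Complex r (Im (a t)))) pj pa q X re im m c v) \<and>
       mono (\<lambda>r. F (a(t := Complex (Re (a t)) r)) pj pa q X re im m c v) \<and>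
       (\<forall>e\<in>edges D.
         antimono (\<lambda>r. F a pj pa q X (upd2 re e t r) im m c v) \<and>
         antimono (\<lambda>r. F a pj pa q X re (upd2 im e t r) m c v) \<and>
         mono (\<lambda>r. F a pj pa q X re im (upd2 m e t r) c v) \<and>
         mono (\<lambda>r. F a pj pa q X re im m (upd2 c e t r) v)) \<and>
       (\<forall>i\<in>buses D. antimono (\<lambda>r. F a pj pa q X re im m c (upd2 v i t r)))))"

definition expected_cost :: "('w, 'x) opf \<Rightarrow> ('w \<Rightarrow> decision \<Rightarrow> real) \<Rightarrow> 'w opf_vars \<Rightarrow> real"
  where "expected_cost D C y = (\<Sum>\<omega>\<in>scenarios D. weight D \<omega> * C \<omega> (decision_of y \<omega>))"

definition val_P :: "('w, 'x) opf \<Rightarrow> ('w \<Rightarrow> decision \<Rightarrow> real) \<Rightarrow> ereal"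
  where "val_P D C =
    (INF y \<in> {y. base_feasible D y \<and> nonconvex_constraint D y}. ereal (expected_cost D C y))"

definition val_SOC :: "('w, 'x) opf \<Rightarrow> ('w \<Rightarrow> decision \<Rightarrow> real) \<Rightarrow> ereal"
  where "val_SOC D C =
    (INF y \<in> {y. base_feasible D y \<and> soc_constraint D y}. ereal (expected_cost D C y))"

definition s_upper :: "('w, 'x) opf \<Rightarrow> bus \<Rightarrow> nat \<Rightarrow> 'w \<Rightarrow> complex"
  where "s_upper D i t \<omega> =
    complex_of_real (pinj_max D i) + \<i> * complex_of_real (q_max D i) - demand D i t \<omega>"

text \<open>On a rooted tree these equations determine \<open>vL\<close> and \<open>SL\<close> uniquely on the index sets.\<close>

definition upper_lin_flow ::
  "('w, 'x) opf \<Rightarrow> (bus \<Rightarrow> nat \<Rightarrow> 'w \<Rightarrow> real) \<Rightarrow> (edge \<Rightarrow> nat \<Rightarrow> 'w \<Rightarrow> complex) \<Rightarrow> bool"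
  where "upper_lin_flow D vL SL \<longleftrightarrow>
    (\<forall>t\<in>steps D. \<forall>\<omega>\<in>scenarios D.
      (\<forall>(i, j)\<in>edges D. SL (i, j) t \<omega> = (\<Sum>k | (k, i) \<in> edges D. SL (k, i) t \<omega>) + s_upper D i t \<omega>) \<and>
      vL 0 t \<omega> = 1 \<and>
      (\<forall>(i, j)\<in>edges D. vL i t \<omega> - vL j t \<omega> = 2 * Re (cnj (impedance D (i, j)) * SL (i, j) t \<omega>)))"

end

theory Submission
  imports Defs
begin

text \<open>Exact points satisfy the relaxed constraint, so the content is that every feasible point of
  the relaxation can be turned into an exact one that costs no more. The powers injected and absorbed
  at the buses other than the slack bus and the states of charge are kept. Only the slack injection,
  currents, line flows and voltages are changed, separately at each time step and scenario.

  On a tree, the flow equations with the injections held fixed express the line flows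
  \<open>S(x)\<close> and the squared voltages \<open>v(x)\<close> as explicit affine functions of the squared
  currents \<open>x\<close>. If \<open>c\<close> are the currents of the given point, then the flow on \<open>(i, j)\<close>
  changes by the sum of \<open>z\<^sub>e (c\<^sub>e - x\<^sub>e)\<close> over the edges \<open>e\<close> below \<open>i\<close>. Since the network
  is passive, lower currents mean larger real and imaginary parts of all flows, and larger voltages.
  They also mean smaller moduli of the flows (\<open>cmod_flow_at_mono\<close>): for nonnegative \<open>x\<close> the
  flow \<open>S(x)\<close> lies componentwise below the linearized flow, which has
  \<open>Re (cnj z\<^sub>e * SL) \<le> 0\<close>. Hence \<open>Re (cnj z\<^sub>e * S(x)) \<le> 0\<close>, and the change of
  \<open>S\<close> points against \<open>S(x)\<close>.

  So the map sending \<open>x\<close> to \<open>|S(x)|\<^sup>2 / v(x)\<close> is monotone on the box \<open>[0, c]\<close>, and the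
  relaxed constraint says that it maps \<open>c\<close> below \<open>c\<close>. By Tarski's argument it has a fixed
  point in the box (\<open>exact_current\<close>), that is, an exact power flow. All quantities moved in
  the direction in which the cost decreases. The bounds survive as well: currents and moduli went
  down, and voltages went up but stay below the linearized ones (\<open>volt_at_le_lin\<close>).

  The exact flows must not anticipate the future. The new point at \<open>(t, \<omega>)\<close> is therefore computed
  from one representative of the scenarios indistinguishable from \<open>\<omega>\<close> up to \<open>t\<close>. This is
  legitimate because the given point takes the same values at all of them
  (\<open>exact_improvement_cong\<close>).\<close>

section \<open>Sums over subtrees and paths to the root\<close>

locale rooted_forest =
  fixes E :: "('a \<times> 'a) set"
  assumes finite_E: "finite E"
    and acyclic_E: "acyclic E"
    and single_valued_E: "single_valued E"
begin

definition below :: "'a \<Rightarrow> ('a \<times> 'a) set"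
  where "below i = {(k, l). (k, l) \<in> E \<and> (l, i) \<in> E\<^sup>*}"

definition above :: "'a \<Rightarrow> ('a \<times> 'a) set"
  where "above i = {(k, l). (k, l) \<in> E \<and> (i, k) \<in> E\<^sup>*}"

lemma below_subset: "below i \<subseteq> E" and above_subset: "above i \<subseteq> E"
  by (auto simp: below_def above_def)

lemma finite_below [simp]: "finite (below i)" and finite_above [simp]: "finite (above i)"
  using finite_subset[OF below_subset finite_E] finite_subset[OF above_subset finite_E] .

lemma finite_children [simp]: "finite {k. (k, i) \<in> E}"
proof (rule finite_subset)
  show "{k. (k, i) \<in> E} \<subseteq> fst ` E" by force
qed (simp add: finite_E)

lemma no_return: "(i, j) \<in> E \<Longrightarrow> (j, i) \<notin> E\<^sup>*"
  using acyclic_E unfolding acyclic_def by (meson rtrancl_into_trancl2)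

lemma siblings_incomparable:
  assumes "(k, i) \<in> E" "(k', i) \<in> E" "k \<noteq> k'"
  shows "(k, k') \<notin> E\<^sup>*"
proof
  assume "(k, k') \<in> E\<^sup>*"
  then obtain m where m: "(k, m) \<in> E" "(m, k') \<in> E\<^sup>*"
    using assms(3) by (metis converse_rtranclE)
  then have "m = i" using assms(1) single_valued_E by (auto simp: single_valued_def)
  then show False using m no_return[OF assms(2)] by simp
qed

lemma below_children: "below i = (\<Union>k\<in>{k. (k, i) \<in> E}. insert (k, i) (below k))"
proof (intro set_eqI iffI)
  fix e assume e: "e \<in> below i"
  then obtain a b where ab: "e = (a, b)" "(a, b) \<in> E" "(b, i) \<in> E\<^sup>*" by (auto simp: below_def)
  from ab(3) show "e \<in> (\<Union>k\<in>{k. (k, i) \<in> E}. insert (k, i) (below k))"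
  proof (cases rule: rtranclE)
    case base
    then show ?thesis using ab by auto
  next
    case (step k)
    then show ?thesis using ab by (auto simp: below_def)
  qed
next
  fix e assume "e \<in> (\<Union>k\<in>{k. (k, i) \<in> E}. insert (k, i) (below k))"
  then show "e \<in> below i" by (auto simp: below_def intro: rtrancl_into_rtrancl)
qed

text \<open>The subtree of \<open>i\<close> splits into the edges from its children and their subtrees. This
  recursion has the shape of the power balance at \<open>i\<close>, and makes a sum over the subtree solve
  it.\<close>

lemma sum_below:
  fixes f :: "'a \<times> 'a \<Rightarrow> 'b::comm_monoid_add"
  shows "(\<Sum>e\<in>below i. f e) = (\<Sum>k | (k, i) \<in> E. f (k, i) + (\<Sum>e\<in>below k. f e))"
proof -
  have disj: "insert (k, i) (below k) \<inter> insert (k', i) (below k') = {}"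
    if k: "(k, i) \<in> E" "(k', i) \<in> E" "k \<noteq> k'" for k k'
  proof -
    have False if "(b, k) \<in> E\<^sup>*" "(b, k') \<in> E\<^sup>*" for b
      using single_valued_confluent[OF single_valued_E that] siblings_incomparable k by metis
    then have "below k \<inter> below k' = {}" by (auto simp: below_def)
    moreover have "(k', i) \<notin> below k" "(k, i) \<notin> below k'"
      using no_return[OF k(1)] no_return[OF k(2)] by (auto simp: below_def)
    ultimately show ?thesis using k(3) by blast
  qed
  have "(\<Sum>e\<in>below i. f e) = (\<Sum>k | (k, i) \<in> E. \<Sum>e\<in>insert (k, i) (below k). f e)"
    unfolding below_children[of i] by (rule sum.UNION_disjoint) (use disj in auto)
  also have "\<dots> = (\<Sum>k | (k, i) \<in> E. f (k, i) + (\<Sum>e\<in>below k. f e))"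
  proof (rule sum.cong)
    fix k assume "k \<in> {k. (k, i) \<in> E}"
    then have "(k, i) \<notin> below k" using no_return by (auto simp: below_def)
    then show "(\<Sum>e\<in>insert (k, i) (below k). f e) = f (k, i) + (\<Sum>e\<in>below k. f e)" by simp
  qed simp
  finally show ?thesis .
qed

text \<open>The counterpart for the voltage drop along the path to the root.\<close>

lemma sum_above:
  fixes f :: "'a \<times> 'a \<Rightarrow> 'b::comm_monoid_add"
  assumes "(i, j) \<in> E"
  shows "(\<Sum>e\<in>above i. f e) = f (i, j) + (\<Sum>e\<in>above j. f e)"
proof -
  have "above i = insert (i, j) (above j)"
  proof (intro set_eqI iffI)
    fix e assume "e \<in> above i"
    then obtain a b where ab: "e = (a, b)" "(a, b) \<in> E" "(i, a) \<in> E\<^sup>*" by (auto simp: above_def)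
    from ab(3) show "e \<in> insert (i, j) (above j)"
    proof (cases rule: converse_rtranclE)
      case base
      then show ?thesis using ab assms single_valued_E by (auto simp: single_valued_def)
    next
      case (step m)
      then have "m = j" using assms single_valued_E by (auto simp: single_valued_def)
      then show ?thesis using step ab by (auto simp: above_def)
    qed
  next
    fix e assume "e \<in> insert (i, j) (above j)"
    then show "e \<in> above i"
      using assms by (auto simp: above_def intro: converse_rtrancl_into_rtrancl)
  qed
  moreover have "(i, j) \<notin> above j" using no_return[OF assms] by (auto simp: above_def)
  ultimately show ?thesis by simp
qed

lemma above_root: "r \<notin> Domain E \<Longrightarrow> above r = {}"
proof -
  assume r: "r \<notin> Domain E"
  have "a = r" if "(r, a) \<in> E\<^sup>*" for a
    using that r by (metis Not_Domain_rtrancl)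
  then show "above r = {}" using r unfolding above_def by blast
qed

end


section \<open>Componentwise monotonicity\<close>

text \<open>Only finitely many components differ, so they can be exchanged one at a time. Finiteness of
  \<open>A\<close> is essential: monotonicity in single components says nothing about infinitely many
  simultaneous changes.\<close>

lemma mono_in_each_component:
  fixes H :: "('a \<Rightarrow> real) \<Rightarrow> real"
  assumes "finite A" and mono: "\<And>h x. x \<in> A \<Longrightarrow> mono (\<lambda>r. H (h(x := r)))"
    and "\<And>x. x \<in> A \<Longrightarrow> f x \<le> g x" and "\<And>x. x \<notin> A \<Longrightarrow> f x = g x"
  shows "H f \<le> H g"
  using assms
proof (induction A arbitrary: g rule: finite_induct)
  case empty
  then have "f = g" by auto
  then show ?case by simp
next
  case (insert x A)
  have "H f \<le> H (g(x := f x))"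
  proof (rule insert.IH)
    show "mono (\<lambda>r. H (h(d := r)))" if "d \<in> A" for h d
      by (rule insert.prems(1)) (use that in simp)
    show "f d \<le> (g(x := f x)) d" if "d \<in> A" for d
      using insert.prems(2)[of d] that insert.hyps by auto
    show "f d = (g(x := f x)) d" if "d \<notin> A" for d
      using insert.prems(3)[of d] that by auto
  qed
  also have "\<dots> \<le> H (g(x := g x))"
    by (rule monoD[OF insert.prems(1)[of x g]]) (use insert.prems(2)[of x] in auto)
  finally show ?case by simp
qed

lemma mono_in_each_component_upd2:
  fixes H :: "('a \<Rightarrow> nat \<Rightarrow> real) \<Rightarrow> real"
  assumes "finite A" "finite B"
    and mono: "\<And>h x t. x \<in> A \<Longrightarrow> t \<in> B \<Longrightarrow> mono (\<lambda>r. H (upd2 h x t r))"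
    and le: "\<And>x t. x \<in> A \<Longrightarrow> t \<in> B \<Longrightarrow> f x t \<le> g x t"
    and eq: "\<And>x t. \<not> (x \<in> A \<and> t \<in> B) \<Longrightarrow> f x t = g x t"
  shows "H f \<le> H g"
proof -
  have upd: "curry (h((x, t) := r)) = upd2 (curry h) x t r" for h :: "'a \<times> nat \<Rightarrow> real" and x t r
    by (auto simp: upd2_def fun_eq_iff)
  have "H (curry (case_prod f)) \<le> H (curry (case_prod g))"
  proof (rule mono_in_each_component[where A = "A \<times> B" and H = "\<lambda>h. H (curry h)"])
    show "mono (\<lambda>r. H (curry (h(d := r))))" if "d \<in> A \<times> B" for h d
      using mono[of "fst d" "snd d" "curry h"] that upd[of h "fst d" "snd d"] by auto
    show "case_prod f d \<le> case_prod g d" if "d \<in> A \<times> B" for d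
      using le[of "fst d" "snd d"] that by auto
    show "case_prod f d = case_prod g d" if "d \<notin> A \<times> B" for d
      using eq[of "fst d" "snd d"] that by (cases d) auto
  qed (simp add: assms)
  then show ?thesis by simp
qed

lemma antimono_in_each_component_upd2:
  fixes H :: "('a \<Rightarrow> nat \<Rightarrow> real) \<Rightarrow> real"
  assumes "finite A" "finite B"
    and anti: "\<And>h x t. x \<in> A \<Longrightarrow> t \<in> B \<Longrightarrow> antimono (\<lambda>r. H (upd2 h x t r))"
    and le: "\<And>x t. x \<in> A \<Longrightarrow> t \<in> B \<Longrightarrow> f x t \<le> g x t"
    and eq: "\<And>x t. \<not> (x \<in> A \<and> t \<in> B) \<Longrightarrow> f x t = g x t"
  shows "H g \<le> H f"
proof -
  have "- H f \<le> - H g"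
  proof (rule mono_in_each_component_upd2[where A = A and B = B and H = "\<lambda>h. - H h"])
    show "mono (\<lambda>r. - H (upd2 h x t r))" if "x \<in> A" "t \<in> B" for h x t
      using anti[OF that, of h] by (simp add: monotone_def)
  qed (use assms(1,2) le eq in blast)+
  then show ?thesis by simp
qed

text \<open>The arguments are exchanged one family at a time. The intermediate arguments combine moduli
  with real and imaginary parts that do not belong to any complex number, so the chain runs through
  values of the separated cost \<open>F\<close>, not of \<open>C\<close>.\<close>

lemma monotone_cost_le:
  assumes cost: "monotone_cost D C" and w: "\<omega> \<in> scenarios D" and fin: "finite (edges D)"
    and a: "\<And>t. t \<in> steps D \<Longrightarrow> Re (a' t) \<le> Re (a t) \<and> Im (a' t) \<le> Im (a t)"
      "\<And>t. t \<notin> steps D \<Longrightarrow> a' t = a t"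
    and S: "\<And>e t. e \<in> edges D \<Longrightarrow> t \<in> steps D \<Longrightarrow> Re (S e t) \<le> Re (S' e t) \<and>
        Im (S e t) \<le> Im (S' e t) \<and> cmod (S' e t) \<le> cmod (S e t)"
      "\<And>e t. \<not> (e \<in> edges D \<and> t \<in> steps D) \<Longrightarrow> S' e t = S e t"
    and c: "\<And>e t. e \<in> edges D \<Longrightarrow> t \<in> steps D \<Longrightarrow> c' e t \<le> c e t"
      "\<And>e t. \<not> (e \<in> edges D \<and> t \<in> steps D) \<Longrightarrow> c' e t = c e t"
    and v: "\<And>i t. i \<in> buses D \<Longrightarrow> t \<in> steps D \<Longrightarrow> v i t \<le> v' i t"
      "\<And>i t. \<not> (i \<in> buses D \<and> t \<in> steps D) \<Longrightarrow> v' i t = v i t"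
  shows "C \<omega> (a', pj, pa, q, X, S', c', v') \<le> C \<omega> (a, pj, pa, q, X, S, c, v)"
proof -
  have finT: "finite (steps D)" and finB: "finite (buses D)" by (auto simp: steps_def buses_def)
  obtain F where F: "\<forall>a pj pa q X S c v. C \<omega> (a, pj, pa, q, X, S, c, v) =
       F a pj pa q X (\<lambda>e t. Re (S e t)) (\<lambda>e t. Im (S e t)) (\<lambda>e t. cmod (S e t)) c v"
    and M: "\<forall>a pj pa q X re im m c v. \<forall>t\<in>steps D.
       mono (\<lambda>r. F (a(t := Complex r (Im (a t)))) pj pa q X re im m c v) \<and>
       mono (\<lambda>r. F (a(t := Complex (Re (a t)) r)) pj pa q X re im m c v) \<and>
       (\<forall>e\<in>edges D.
         antimono (\<lambda>r. F a pj pa q X (upd2 re e t r) im m c v) \<and>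
         antimono (\<lambda>r. F a pj pa q X re (upd2 im e t r) m c v) \<and>
         mono (\<lambda>r. F a pj pa q X re im (upd2 m e t r) c v) \<and>
         mono (\<lambda>r. F a pj pa q X re im m (upd2 c e t r) v)) \<and>
       (\<forall>i\<in>buses D. antimono (\<lambda>r. F a pj pa q X re im m c (upd2 v i t r)))"
    using cost[unfolded monotone_cost_def, THEN bspec, OF w]
    by (elim exE conjE) (rule that)
  have M_re: "mono (\<lambda>r. F (a(t := Complex r (Im (a t)))) pj pa q X re im m c v)"
    and M_im: "mono (\<lambda>r. F (a(t := Complex (Re (a t)) r)) pj pa q X re im m c v)"
    if "t \<in> steps D" for t a re im m c v
    using M that by blast+
  have M_S: "antimono (\<lambda>r. F a pj pa q X (upd2 re e t r) im m c v)"
      "antimono (\<lambda>r. F a pj pa q X re (upd2 im e t r) m c v)"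
      "mono (\<lambda>r. F a pj pa q X re im (upd2 m e t r) c v)"
      "mono (\<lambda>r. F a pj pa q X re im m (upd2 c e t r) v)"
    if "e \<in> edges D" "t \<in> steps D" for e t a re im m c v
    using M that by blast+
  have M_v: "antimono (\<lambda>r. F a pj pa q X re im m c (upd2 v i t r))"
    if "i \<in> buses D" "t \<in> steps D" for i t a re im m c v
    using M that by blast
  let ?re = "\<lambda>e t. Re (S e t)" and ?im = "\<lambda>e t. Im (S e t)" and ?m = "\<lambda>e t. cmod (S e t)"
  let ?re' = "\<lambda>e t. Re (S' e t)" and ?im' = "\<lambda>e t. Im (S' e t)" and ?m' = "\<lambda>e t. cmod (S' e t)"
  \<comment> \<open>An update in the family of real or imaginary parts is an update of the complex family, of the
    form in which monotonicity is assumed\<close>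
  have updRe: "(\<lambda>u. Complex ((h(t := r)) u) (b u)) =
      (\<lambda>u. Complex (h u) (b u))(t := Complex r (Im (Complex (h t) (b t))))"
    and updIm: "(\<lambda>u. Complex (b u) ((h(t := r)) u)) =
      (\<lambda>u. Complex (b u) (h u))(t := Complex (Re (Complex (b t) (h t))) r)"
    for h b :: "nat \<Rightarrow> real" and t r by (auto simp: fun_eq_iff)
  have "F (\<lambda>u. Complex (Re (a' u)) (Im (a' u))) pj pa q X ?re' ?im' ?m' c' v'
      \<le> F (\<lambda>u. Complex (Re (a u)) (Im (a' u))) pj pa q X ?re' ?im' ?m' c' v'"
  proof (rule mono_in_each_component[where A = "steps D" and
        H = "\<lambda>h. F (\<lambda>u. Complex (h u) (Im (a' u))) pj pa q X ?re' ?im' ?m' c' v'"])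
    show "mono (\<lambda>r. F (\<lambda>u. Complex ((h(t := r)) u) (Im (a' u))) pj pa q X ?re' ?im' ?m' c' v')"
      if "t \<in> steps D" for h t
      using M_re[OF that, of "\<lambda>u. Complex (h u) (Im (a' u))"] by (simp only: updRe)
  qed (use a finT in auto)
  also have "\<dots> \<le> F (\<lambda>u. Complex (Re (a u)) (Im (a u))) pj pa q X ?re' ?im' ?m' c' v'"
  proof (rule mono_in_each_component[where A = "steps D" and
        H = "\<lambda>h. F (\<lambda>u. Complex (Re (a u)) (h u)) pj pa q X ?re' ?im' ?m' c' v'"])
    show "mono (\<lambda>r. F (\<lambda>u. Complex (Re (a u)) ((h(t := r)) u)) pj pa q X ?re' ?im' ?m' c' v')"
      if "t \<in> steps D" for h t
      using M_im[OF that, of "\<lambda>u. Complex (Re (a u)) (h u)"] by (simp only: updIm)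
  qed (use a finT in auto)
  also have "\<dots> = F a pj pa q X ?re' ?im' ?m' c' v'" by simp
  also have "\<dots> \<le> F a pj pa q X ?re ?im' ?m' c' v'"
    by (rule antimono_in_each_component_upd2[OF fin finT, where
          H = "\<lambda>h. F a pj pa q X h ?im' ?m' c' v'"]) (simp_all add: M_S S)
  also have "\<dots> \<le> F a pj pa q X ?re ?im ?m' c' v'"
    by (rule antimono_in_each_component_upd2[OF fin finT, where
          H = "\<lambda>h. F a pj pa q X ?re h ?m' c' v'"]) (simp_all add: M_S S)
  also have "\<dots> \<le> F a pj pa q X ?re ?im ?m c' v'"
    by (rule mono_in_each_component_upd2[OF fin finT, where
          H = "\<lambda>h. F a pj pa q X ?re ?im h c' v'"]) (simp_all add: M_S S)
  also have "\<dots> \<le> F a pj pa q X ?re ?im ?m c v'"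
    by (rule mono_in_each_component_upd2[OF fin finT, where
          H = "\<lambda>h. F a pj pa q X ?re ?im ?m h v'"]) (simp_all add: M_S c)
  also have "\<dots> \<le> F a pj pa q X ?re ?im ?m c v"
    by (rule antimono_in_each_component_upd2[OF finB finT, where
          H = "\<lambda>h. F a pj pa q X ?re ?im ?m c h"]) (simp_all add: M_v v)
  finally show ?thesis by (simp add: F)
qed


section \<open>Exact power flows below a relaxed one\<close>

text \<open>Tarski's theorem, for reals and on the components in \<open>E\<close> only: the infimum of the
  pre-fixed points is a fixed point.\<close>

lemma fixed_point_in_box:
  fixes \<Phi> :: "('a \<Rightarrow> real) \<Rightarrow> 'a \<Rightarrow> real"
  assumes nonneg: "\<And>e. e \<in> E \<Longrightarrow> 0 \<le> u e"
    and mono: "\<And>x y e. (\<And>d. d \<in> E \<Longrightarrow> 0 \<le> x d \<and> x d \<le> y d \<and> y d \<le> u d) \<Longrightarrow> e \<in> E \<Longrightarrow> \<Phi> x e \<le> \<Phi> y e"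
    and ge0: "\<And>x e. (\<And>d. d \<in> E \<Longrightarrow> 0 \<le> x d \<and> x d \<le> u d) \<Longrightarrow> e \<in> E \<Longrightarrow> 0 \<le> \<Phi> x e"
    and top: "\<And>e. e \<in> E \<Longrightarrow> \<Phi> u e \<le> u e"
  obtains x where "\<And>e. e \<in> E \<Longrightarrow> 0 \<le> x e \<and> x e \<le> u e" "\<And>e. e \<in> E \<Longrightarrow> \<Phi> x e = x e"
proof -
  define A where "A = {x. \<forall>e\<in>E. 0 \<le> x e \<and> x e \<le> u e \<and> \<Phi> x e \<le> x e}"
  define m where "m = (\<lambda>e. INF x\<in>A. x e)"
  have uA: "u \<in> A" using nonneg top by (auto simp: A_def)
  have le: "m e \<le> x e" if "e \<in> E" "x \<in> A" for e x
    unfolding m_def by (rule cINF_lower) (use that in \<open>auto simp: A_def bdd_below_def\<close>)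
  have ge: "r \<le> m e" if "\<And>x. x \<in> A \<Longrightarrow> r \<le> x e" for e r
    unfolding m_def by (rule cINF_greatest) (use that uA in auto)
  have box: "0 \<le> m e \<and> m e \<le> u e" if "e \<in> E" for e
    using le[OF that uA] ge[of 0 e] that by (auto simp: A_def)
  have pre: "\<Phi> m e \<le> m e" if e: "e \<in> E" for e
  proof (rule ge)
    fix x assume x: "x \<in> A"
    have "\<Phi> m e \<le> \<Phi> x e" by (rule mono) (use box le x e in \<open>auto simp: A_def\<close>)
    then show "\<Phi> m e \<le> x e" using x e by (auto simp: A_def)
  qed
  have "\<Phi> m \<in> A"
    unfolding A_def
  proof (intro CollectI ballI conjI)
    fix e assume e: "e \<in> E"
    show "0 \<le> \<Phi> m e" by (rule ge0) (use box e in auto)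
    show "\<Phi> m e \<le> u e" using pre[OF e] box[OF e] by auto
    show "\<Phi> (\<Phi> m) e \<le> \<Phi> m e"
    proof (rule mono)
      fix d assume d: "d \<in> E"
      show "0 \<le> \<Phi> m d \<and> \<Phi> m d \<le> m d \<and> m d \<le> u d"
        using box d pre ge0[of m d] by auto
    qed (fact e)
  qed
  then have "\<Phi> m e = m e" if "e \<in> E" for e using le[OF that] pre[OF that] by force
  then show ?thesis using box that by blast
qed

lemma Re_cnj_mult: "Re (cnj w * u) = Re w * Re u + Im w * Im u"
  by simp

text \<open>The network at one time step in one scenario, with a solution \<open>(S, c, v)\<close> of the relaxed
  flow equations for the injections \<open>s\<close>, and the lossless flow \<open>SL\<close> of larger injections
  \<open>sL\<close>. Nothing depends on time or on other scenarios here: storage couples time steps only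
  through variables that stay unchanged.\<close>

locale relaxed_flow = rooted_forest E for E :: "('a \<times> 'a) set" +
  fixes z S SL :: "'a \<times> 'a \<Rightarrow> complex" and c :: "'a \<times> 'a \<Rightarrow> real"
    and v :: "'a \<Rightarrow> real" and s sL :: "'a \<Rightarrow> complex"
  assumes z_nonneg: "e \<in> E \<Longrightarrow> 0 \<le> Re (z e) \<and> 0 \<le> Im (z e)"
    and c_nonneg: "e \<in> E \<Longrightarrow> 0 \<le> c e"
    and v_pos: "(i, j) \<in> E \<Longrightarrow> 0 < v i"
    and balance: "(i, j) \<in> E \<Longrightarrow> S (i, j) = (\<Sum>k | (k, i) \<in> E. S (k, i) - z (k, i) * complex_of_real (c (k, i))) + s i"
    and drop: "(i, j) \<in> E \<Longrightarrow> v i - v j = 2 * Re (cnj (z (i, j)) * S (i, j)) - (cmod (z (i, j)))\<^sup>2 * c (i, j)"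
    and relaxed: "(i, j) \<in> E \<Longrightarrow> (cmod (S (i, j)))\<^sup>2 \<le> v i * c (i, j)"
    and s_le: "(i, j) \<in> E \<Longrightarrow> Re (s i) \<le> Re (sL i) \<and> Im (s i) \<le> Im (sL i)"
    and lin_balance: "(i, j) \<in> E \<Longrightarrow> SL (i, j) = (\<Sum>k | (k, i) \<in> E. SL (k, i)) + sL i"
    and lin_sign: "(i, j) \<in> E \<Longrightarrow> e \<in> below i \<Longrightarrow> Re (cnj (z e) * SL (i, j)) \<le> 0"
begin

text \<open>The solution of the flow equations with currents \<open>x\<close> in place of \<open>c\<close>, written as a
  correction of the given solution. In this form the losses saved below a bus are visible as
  multiples of the impedances with factors \<open>c d - x d\<close>, from which every monotonicity below
  is read off.\<close>

definition flow_at :: "('a \<times> 'a \<Rightarrow> real) \<Rightarrow> 'a \<times> 'a \<Rightarrow> complex"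
  where "flow_at x e = S e + (\<Sum>d\<in>below (fst e). z d * complex_of_real (c d - x d))"

definition volt_at :: "('a \<times> 'a \<Rightarrow> real) \<Rightarrow> 'a \<Rightarrow> real"
  where "volt_at x i = v i + (\<Sum>e\<in>above i.
    2 * Re (cnj (z e) * (flow_at x e - S e)) + (cmod (z e))\<^sup>2 * (c e - x e))"

lemma flow_at_balance:
  assumes "(i, j) \<in> E"
  shows "flow_at x (i, j) = (\<Sum>k | (k, i) \<in> E. flow_at x (k, i) - z (k, i) * complex_of_real (x (k, i))) + s i"
  unfolding flow_at_def fst_conv sum_below[of _ i] balance[OF assms]
  by (simp add: sum.distrib sum_subtractf algebra_simps)

lemma volt_at_drop:
  assumes "(i, j) \<in> E"
  shows "volt_at x i - volt_at x j = 2 * Re (cnj (z (i, j)) * flow_at x (i, j)) - (cmod (z (i, j)))\<^sup>2 * x (i, j)"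
  unfolding volt_at_def sum_above[OF assms] using drop[OF assms] by (simp add: algebra_simps)

lemma flow_at_self [simp]: "flow_at c e = S e"
  and volt_at_self [simp]: "volt_at c i = v i"
  by (simp_all add: flow_at_def volt_at_def)

lemma flow_at_diff: "flow_at x e - flow_at y e = (\<Sum>d\<in>below (fst e). z d * complex_of_real (y d - x d))"
  by (simp add: flow_at_def sum_subtractf[symmetric] algebra_simps)

lemma flow_at_antimono:
  assumes "\<And>d. d \<in> E \<Longrightarrow> x d \<le> y d"
  shows "Re (flow_at y e) \<le> Re (flow_at x e)" "Im (flow_at y e) \<le> Im (flow_at x e)"
proof -
  have "0 \<le> Re (flow_at x e - flow_at y e)" "0 \<le> Im (flow_at x e - flow_at y e)"
    unfolding flow_at_diff Re_sum Im_sum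
    by (intro sum_nonneg; use below_subset assms z_nonneg in force)+
  then show "Re (flow_at y e) \<le> Re (flow_at x e)" "Im (flow_at y e) \<le> Im (flow_at x e)" by auto
qed

lemma volt_at_antimono:
  assumes "\<And>d. d \<in> E \<Longrightarrow> x d \<le> y d"
  shows "volt_at y i \<le> volt_at x i"
  unfolding volt_at_def
proof (intro add_left_mono sum_mono)
  fix e assume "e \<in> above i"
  then have e: "e \<in> E" using above_subset by blast
  have "(cmod (z e))\<^sup>2 * (c e - y e) \<le> (cmod (z e))\<^sup>2 * (c e - x e)"
    using assms[OF e] by (intro mult_left_mono) auto
  moreover have "Re (z e) * Re (flow_at y e) \<le> Re (z e) * Re (flow_at x e)"
    "Im (z e) * Im (flow_at y e) \<le> Im (z e) * Im (flow_at x e)"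
    using z_nonneg[OF e] flow_at_antimono[of x y e, OF assms] by (auto intro: mult_left_mono)
  ultimately show "2 * Re (cnj (z e) * (flow_at y e - S e)) + (cmod (z e))\<^sup>2 * (c e - y e)
      \<le> 2 * Re (cnj (z e) * (flow_at x e - S e)) + (cmod (z e))\<^sup>2 * (c e - x e)"
    by (simp add: algebra_simps)
qed

text \<open>The linearized flow has larger injections and no losses. The comparison is carried from the
  leaves towards the root.\<close>

lemma flow_at_le_lin:
  assumes x: "\<And>d. d \<in> E \<Longrightarrow> 0 \<le> x d" and "(i, j) \<in> E"
  shows "Re (flow_at x (i, j)) \<le> Re (SL (i, j)) \<and> Im (flow_at x (i, j)) \<le> Im (SL (i, j))"
  using assms(2)
proof (induction i arbitrary: j rule: wf_induct_rule[OF finite_acyclic_wf[OF finite_E acyclic_E]])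
  case (1 i)
  have "Re (flow_at x (k, i) - z (k, i) * complex_of_real (x (k, i))) \<le> Re (SL (k, i)) \<and>
        Im (flow_at x (k, i) - z (k, i) * complex_of_real (x (k, i))) \<le> Im (SL (k, i))"
    if k: "(k, i) \<in> E" for k
    using "1.IH"[OF k k] mult_nonneg_nonneg[OF _ x[OF k]] z_nonneg[OF k] by fastforce
  then have "(\<Sum>k | (k, i) \<in> E. Re (flow_at x (k, i) - z (k, i) * complex_of_real (x (k, i))))
      \<le> (\<Sum>k | (k, i) \<in> E. Re (SL (k, i)))"
    "(\<Sum>k | (k, i) \<in> E. Im (flow_at x (k, i) - z (k, i) * complex_of_real (x (k, i))))
      \<le> (\<Sum>k | (k, i) \<in> E. Im (SL (k, i)))"
    by (auto intro!: sum_mono)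
  then show ?case
    using s_le[OF "1.prems"]
    unfolding flow_at_balance[OF "1.prems"] lin_balance[OF "1.prems"] plus_complex.sel Re_sum Im_sum
    by linarith
qed

text \<open>With \<open>w\<close> the increase of the flow \<open>f\<close> obtained from the smaller currents, the old
  flow has squared modulus \<open>|f|\<^sup>2 - 2 Re (cnj w * f) + |w|\<^sup>2\<close>. The increase is a nonnegative
  combination of the impedances below \<open>i\<close>, and each of them forms an obtuse angle with \<open>f\<close>
  because it does so with the larger \<open>SL\<close>.\<close>

lemma cmod_flow_at_mono:
  assumes x: "\<And>d. d \<in> E \<Longrightarrow> 0 \<le> x d" and xy: "\<And>d. d \<in> E \<Longrightarrow> x d \<le> y d" and ij: "(i, j) \<in> E"
  shows "cmod (flow_at x (i, j)) \<le> cmod (flow_at y (i, j))"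
proof -
  define f where "f = flow_at x (i, j)"
  define w where "w = f - flow_at y (i, j)"
  have sign: "Re (cnj (z d) * f) \<le> 0" if d: "d \<in> below i" for d
  proof -
    have "Re (cnj (z d) * f) \<le> Re (cnj (z d) * SL (i, j))"
      unfolding Re_cnj_mult f_def
      using flow_at_le_lin[of x, OF x ij] z_nonneg[of d] d below_subset
      by (intro add_mono mult_left_mono) auto
    then show ?thesis using lin_sign[OF ij d] by linarith
  qed
  have "Re (cnj w * f) = (\<Sum>d\<in>below i. (y d - x d) * Re (cnj (z d) * f))"
    unfolding w_def f_def flow_at_diff fst_conv
    by (simp add: sum_distrib_right sum_distrib_left sum.distrib[symmetric] sum_subtractf[symmetric] algebra_simps)
  also have "\<dots> \<le> 0"
    using sign xy below_subset by (intro sum_nonpos mult_nonneg_nonpos) force+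
  finally have "Re (cnj w * f) \<le> 0" .
  moreover have "(cmod (flow_at y (i, j)))\<^sup>2 = (cmod f)\<^sup>2 - 2 * Re (cnj w * f) + (cmod w)\<^sup>2"
    unfolding cmod_power2 Re_cnj_mult by (simp add: w_def algebra_simps power2_eq_square)
  ultimately have "(cmod f)\<^sup>2 \<le> (cmod (flow_at y (i, j)))\<^sup>2"
    using zero_le_power2[of "cmod w"] by linarith
  then show ?thesis unfolding f_def by (rule power2_le_imp_le) simp
qed

text \<open>Going away from the root, each drop equation of the linearized flow adds at least as much
  voltage: its flow is larger and it lacks the negative loss term.\<close>

lemma volt_at_le_lin:
  assumes x: "\<And>d. d \<in> E \<Longrightarrow> 0 \<le> x d" and r: "r \<notin> Domain E" "v r \<le> vL r"
    and lin_drop: "\<And>i j. (i, j) \<in> E \<Longrightarrow> vL i - vL j = 2 * Re (cnj (z (i, j)) * SL (i, j))"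
    and "(i, r) \<in> E\<^sup>*"
  shows "volt_at x i \<le> vL i"
  using \<open>(i, r) \<in> E\<^sup>*\<close>
proof (induction rule: converse_rtrancl_induct)
  case base
  then show ?case using r by (simp add: volt_at_def above_root)
next
  case (step i j)
  have "Re (cnj (z (i, j)) * flow_at x (i, j)) \<le> Re (cnj (z (i, j)) * SL (i, j))"
    unfolding Re_cnj_mult using flow_at_le_lin[of x, OF x step(1)] z_nonneg[OF step(1)]
    by (intro add_mono mult_left_mono) auto
  moreover have "0 \<le> (cmod (z (i, j)))\<^sup>2 * x (i, j)" using x[OF step(1)] by simp
  ultimately show ?case
    using step.IH volt_at_drop[OF step(1), of x] lin_drop[OF step(1)] by linarith
qed

text \<open>The fixed point equation divides the exactness constraint by the voltage, which stays
  positive because it can only rise above the given one.\<close>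

lemma exact_current:
  obtains x where "\<And>e. e \<in> E \<Longrightarrow> 0 \<le> x e \<and> x e \<le> c e"
    "\<And>i j. (i, j) \<in> E \<Longrightarrow> volt_at x i * x (i, j) = (cmod (flow_at x (i, j)))\<^sup>2"
proof -
  define \<Phi> where "\<Phi> x e = (cmod (flow_at x e))\<^sup>2 / volt_at x (fst e)" for x e
  have pos: "0 < volt_at x i" if "\<And>d. d \<in> E \<Longrightarrow> x d \<le> c d" "(i, j) \<in> E" for x i j
    using volt_at_antimono[of x c i] that v_pos[of i j] by force
  obtain x where x: "\<And>e. e \<in> E \<Longrightarrow> 0 \<le> x e \<and> x e \<le> c e" "\<And>e. e \<in> E \<Longrightarrow> \<Phi> x e = x e"
  proof (rule fixed_point_in_box[of E c \<Phi>])
    fix x y e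
    assume xy: "\<And>d. d \<in> E \<Longrightarrow> 0 \<le> x d \<and> x d \<le> y d \<and> y d \<le> c d" and e: "e \<in> E"
    obtain i j where ij: "e = (i, j)" by (cases e)
    have "volt_at y i \<le> volt_at x i" by (rule volt_at_antimono) (use xy in auto)
    moreover have "0 < volt_at y i" by (rule pos) (use xy e ij in auto)
    moreover have "cmod (flow_at x e) \<le> cmod (flow_at y e)"
      unfolding ij by (rule cmod_flow_at_mono) (use xy e ij in auto)
    ultimately show "\<Phi> x e \<le> \<Phi> y e"
      unfolding \<Phi>_def ij by (auto intro!: frac_le power_mono)
  next
    fix x e
    assume x: "\<And>d. d \<in> E \<Longrightarrow> 0 \<le> x d \<and> x d \<le> c d" and e: "e \<in> E"
    have "0 < volt_at x (fst e)" by (rule pos[of x _ "snd e"]) (use x e in auto)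
    then show "0 \<le> \<Phi> x e" by (simp add: \<Phi>_def)
  next
    fix e assume e: "e \<in> E"
    then show "\<Phi> c e \<le> c e"
      using relaxed[of "fst e" "snd e"] v_pos[of "fst e" "snd e"]
      by (simp add: \<Phi>_def divide_simps mult.commute)
  qed (use c_nonneg in auto)
  show ?thesis
  proof (rule that)
    show "volt_at x i * x (i, j) = (cmod (flow_at x (i, j)))\<^sup>2" if "(i, j) \<in> E" for i j
      using x(2)[OF that] pos[of x i j] x(1) that by (auto simp: \<Phi>_def field_simps)
  qed (use x in auto)
qed

end


section \<open>The multistage problem\<close>

lemma finite_edges: "radial_connected D \<Longrightarrow> finite (edges D)"
  unfolding radial_connected_def buses_def by (meson finite_SigmaI finite_atLeastAtMost finite_subset)

lemma edge_source:
  "radial_connected D \<Longrightarrow> (i, j) \<in> edges D \<Longrightarrow> i \<in> buses D - {0}"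
  by (auto simp: radial_connected_def)

text \<open>No cycle can occur: parents are unique, so a cycle through \<open>i\<close> would contain every
  vertex on the path from \<open>i\<close> to the root, but no edge leaves the root.\<close>

lemma rooted_forest_edges:
  assumes D: "radial_connected D"
  shows "rooted_forest (edges D)"
proof
  show "finite (edges D)" using finite_edges[OF D] .
  show sv: "single_valued (edges D)"
    using D edge_source[OF D] unfolding radial_connected_def single_valued_def by blast
  show "acyclic (edges D)"
    unfolding acyclic_def
  proof (intro allI notI)
    fix i assume cyc: "(i, i) \<in> (edges D)\<^sup>+"
    then have "i \<in> buses D" using edge_source[OF D] by (meson DiffD1 converse_tranclE)
    then have "(i, 0) \<in> (edges D)\<^sup>*" using D by (auto simp: radial_connected_def)
    then have "(i, i) \<notin> (edges D)\<^sup>+"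
    proof (induction rule: converse_rtrancl_induct)
      case base
      show ?case using D by (auto simp: radial_connected_def dest: tranclD)
    next
      case (step i j)
      show ?case
      proof
        assume "(i, i) \<in> (edges D)\<^sup>+"
        then obtain m where "(i, m) \<in> edges D" "(m, i) \<in> (edges D)\<^sup>*" by (meson tranclD)
        then have "(j, i) \<in> (edges D)\<^sup>*" using sv step(1) by (auto simp: single_valued_def)
        then show False using step by (meson rtrancl_into_trancl1)
      qed
    qed
    then show False using cyc by simp
  qed
qed

text \<open>The tuple holds the new \<open>(s0, S, \<I>, v)\<close> at a single \<open>(t, \<omega>)\<close>. Keeping the
  choice local in time and scenario lets it be made once for each class of indistinguishable
  scenarios.\<close>

definition exact_improvement :: "('w, 'x) opf \<Rightarrow> 'w opf_vars \<Rightarrow> nat \<Rightarrow> 'w \<Rightarrow>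
    complex \<times> (edge \<Rightarrow> complex) \<times> (edge \<Rightarrow> real) \<times> (bus \<Rightarrow> real) \<Rightarrow> bool"
  where "exact_improvement D y t \<omega> = (\<lambda>(a, S, c, v).
    (Re a \<le> Re (s0 y t \<omega>) \<and> Im a \<le> Im (s0 y t \<omega>)) \<and>
    (\<forall>e\<in>edges D. 0 \<le> c e \<and> c e \<le> cur y e t \<omega> \<and> Re (flow y e t \<omega>) \<le> Re (S e) \<and>
       Im (flow y e t \<omega>) \<le> Im (S e) \<and> cmod (S e) \<le> cmod (flow y e t \<omega>)) \<and>
    v 0 = 1 \<and> (\<forall>i\<in>buses D. vsq y i t \<omega> \<le> v i \<and> (i \<noteq> 0 \<longrightarrow> v i \<le> v_max D i)) \<and>
    (\<forall>(i, j)\<in>edges D. S (i, j) =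
       (\<Sum>k | (k, i) \<in> edges D. S (k, i) - impedance D (k, i) * complex_of_real (c (k, i))) + sinj y i t \<omega>) \<and>
    0 = (\<Sum>k | (k, 0) \<in> edges D. S (k, 0) - impedance D (k, 0) * complex_of_real (c (k, 0))) + a \<and>
    (\<forall>(i, j)\<in>edges D. v i - v j = 2 * Re (cnj (impedance D (i, j)) * S (i, j))
       - (cmod (impedance D (i, j)))\<^sup>2 * c (i, j)) \<and>
    (\<forall>(i, j)\<in>edges D. v i * c (i, j) = (cmod (S (i, j)))\<^sup>2))"

text \<open>The slack injection is determined by the balance at the root. It decreases because the flows
  into the root grow while the losses on the last edges shrink.\<close>

lemma exact_improvement_exists:
  assumes data: "opf_data D" and lin: "upper_lin_flow D vL SL"
    and D: "radial_connected D" and pass: "passive_network D"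
    and vL: "\<forall>i\<in>buses D. \<forall>t\<in>steps D. \<forall>\<omega>\<in>scenarios D. vL i t \<omega> \<le> v_max D i"
    and SL: "\<forall>(i, j)\<in>edges D. \<forall>(k, l)\<in>subtree_edges D i. \<forall>t\<in>steps D. \<forall>\<omega>\<in>scenarios D.
           Re (cnj (impedance D (k, l)) * SL (i, j) t \<omega>) \<le> 0"
    and y: "base_feasible D y" "soc_constraint D y"
    and t: "t \<in> steps D" and w: "\<omega> \<in> scenarios D"
  shows "\<exists>p. exact_improvement D y t \<omega> p"
proof -
  interpret rooted_forest "edges D" using rooted_forest_edges[OF D] .
  have bounds: "bound_constraints D y t \<omega>" and flows: "flow_constraints D y t \<omega>"
    using y(1) t w by (auto simp: base_feasible_def)
  have lin_S: "SL (i, j) t \<omega> = (\<Sum>k | (k, i) \<in> edges D. SL (k, i) t \<omega>) + s_upper D i t \<omega>"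
    and lin_v: "vL i t \<omega> - vL j t \<omega> = 2 * Re (cnj (impedance D (i, j)) * SL (i, j) t \<omega>)"
    if "(i, j) \<in> edges D" for i j
    using lin that t w unfolding upper_lin_flow_def by blast+
  have lin_root: "vL 0 t \<omega> = 1"
    using lin t w unfolding upper_lin_flow_def by blast
  have below: "below i = subtree_edges D i" for i
    by (auto simp: below_def subtree_edges_def intro: converse_rtrancl_into_rtrancl)
  interpret relaxed_flow "edges D" "impedance D" "\<lambda>e. flow y e t \<omega>" "\<lambda>e. SL e t \<omega>"
    "\<lambda>e. cur y e t \<omega>" "\<lambda>i. vsq y i t \<omega>" "\<lambda>i. sinj y i t \<omega>" "\<lambda>i. s_upper D i t \<omega>"
  proof
    fix i j assume ij: "(i, j) \<in> edges D"
    have i: "i \<in> buses D - {0}" using edge_source[OF D ij] .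
    show "0 < vsq y i t \<omega>"
      using i bounds data by (force simp: bound_constraints_def opf_data_def)
    show "flow y (i, j) t \<omega> = (\<Sum>k | (k, i) \<in> edges D.
          flow y (k, i) t \<omega> - impedance D (k, i) * complex_of_real (cur y (k, i) t \<omega>)) + sinj y i t \<omega>"
      using flows ij by (auto simp: flow_constraints_def)
    show "vsq y i t \<omega> - vsq y j t \<omega> = 2 * Re (cnj (impedance D (i, j)) * flow y (i, j) t \<omega>)
       - (cmod (impedance D (i, j)))\<^sup>2 * cur y (i, j) t \<omega>"
      using flows ij unfolding flow_constraints_def by blast
    show "(cmod (flow y (i, j) t \<omega>))\<^sup>2 \<le> vsq y i t \<omega> * cur y (i, j) t \<omega>"
      using y(2) ij t w by (auto simp: soc_constraint_def)
    have "sinj y i t \<omega> = complex_of_real (pinj y i t \<omega>) - complex_of_real (pabs y i t \<omega>)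
       + \<i> * complex_of_real (qinj y i t \<omega>) - demand D i t \<omega>"
      using flows i by (auto simp: flow_constraints_def)
    moreover have "pinj y i t \<omega> \<le> pinj_max D i" "0 \<le> pabs y i t \<omega>" "qinj y i t \<omega> \<le> q_max D i"
      using bounds i by (auto simp: bound_constraints_def)
    ultimately show "Re (sinj y i t \<omega>) \<le> Re (s_upper D i t \<omega>) \<and> Im (sinj y i t \<omega>) \<le> Im (s_upper D i t \<omega>)"
      by (simp add: s_upper_def)
    show "SL (i, j) t \<omega> = (\<Sum>k | (k, i) \<in> edges D. SL (k, i) t \<omega>) + s_upper D i t \<omega>"
      by (rule lin_S[OF ij])
    show "Re (cnj (impedance D e) * SL (i, j) t \<omega>) \<le> 0" if "e \<in> below i" for e
      using that SL ij t w unfolding below by (cases e) blast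
  qed (use pass bounds in \<open>auto simp: passive_network_def bound_constraints_def\<close>)
  obtain x where x: "\<And>e. e \<in> edges D \<Longrightarrow> 0 \<le> x e \<and> x e \<le> cur y e t \<omega>"
    and exact: "\<And>i j. (i, j) \<in> edges D \<Longrightarrow> volt_at x i * x (i, j) = (cmod (flow_at x (i, j)))\<^sup>2"
    by (rule exact_current) blast
  let ?c = "\<lambda>e. cur y e t \<omega>"
  have mag: "cmod (flow_at x e) \<le> cmod (flow y e t \<omega>)" if "e \<in> edges D" for e
    using cmod_flow_at_mono[of x ?c "fst e" "snd e"] x that by simp
  have ReS: "Re (flow y e t \<omega>) \<le> Re (flow_at x e)" and ImS: "Im (flow y e t \<omega>) \<le> Im (flow_at x e)" for e
    using flow_at_antimono[of x ?c e] x by auto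
  have v_ge: "vsq y i t \<omega> \<le> volt_at x i" for i
    using volt_at_antimono[of x ?c i] x by auto
  have root: "0 \<notin> Domain (edges D)" using D by (auto simp: radial_connected_def)
  have v_root: "vsq y 0 t \<omega> = 1" using bounds by (simp add: bound_constraints_def)
  have v_le: "volt_at x i \<le> v_max D i" if i: "i \<in> buses D" for i
  proof -
    have "volt_at x i \<le> vL i t \<omega>"
    proof (rule volt_at_le_lin[where r = 0 and vL = "\<lambda>i. vL i t \<omega>"])
      show "(i, 0) \<in> (edges D)\<^sup>*" using D i by (auto simp: radial_connected_def)
    qed (use root x v_root lin_root lin_v in \<open>simp_all only: order_refl simp_thms\<close>)
    then show ?thesis using vL i t w by force
  qed
  define a where "a = - (\<Sum>k | (k, 0) \<in> edges D. flow_at x (k, 0) - impedance D (k, 0) * complex_of_real (x (k, 0)))"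
  have s0: "s0 y t \<omega> = - (\<Sum>k | (k, 0) \<in> edges D. flow y (k, 0) t \<omega> - impedance D (k, 0) * complex_of_real (?c (k, 0)))"
    using flows by (simp add: flow_constraints_def eq_neg_iff_add_eq_0 add.commute)
  have loss: "Re (impedance D e) * x e \<le> Re (impedance D e) * ?c e \<and> Im (impedance D e) * x e \<le> Im (impedance D e) * ?c e"
    if "e \<in> edges D" for e
    using x[OF that] z_nonneg[OF that] by (auto intro: mult_left_mono)
  have inflow: "Re (flow y (k, 0) t \<omega> - impedance D (k, 0) * complex_of_real (?c (k, 0)))
        \<le> Re (flow_at x (k, 0) - impedance D (k, 0) * complex_of_real (x (k, 0)))"
      "Im (flow y (k, 0) t \<omega> - impedance D (k, 0) * complex_of_real (?c (k, 0)))
        \<le> Im (flow_at x (k, 0) - impedance D (k, 0) * complex_of_real (x (k, 0)))"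
    if "(k, 0) \<in> edges D" for k
    using loss[OF that] ReS[of "(k, 0)"] ImS[of "(k, 0)"] by simp_all
  have "Re a \<le> Re (s0 y t \<omega>)" "Im a \<le> Im (s0 y t \<omega>)"
    unfolding a_def s0 uminus_complex.sel Re_sum Im_sum
    by (rule le_imp_neg_le, rule sum_mono, rule inflow, simp)+
  then have "exact_improvement D y t \<omega> (a, flow_at x, x, volt_at x)"
    unfolding exact_improvement_def case_prod_conv
  proof (intro conjI)
    show "volt_at x 0 = 1" using v_root root by (simp add: volt_at_def above_root)
    show "0 = (\<Sum>k | (k, 0) \<in> edges D. flow_at x (k, 0) - impedance D (k, 0) * complex_of_real (x (k, 0))) + a"
      by (simp add: a_def)
    show "\<forall>(i, j)\<in>edges D. flow_at x (i, j) = (\<Sum>k | (k, i) \<in> edges D.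
        flow_at x (k, i) - impedance D (k, i) * complex_of_real (x (k, i))) + sinj y i t \<omega>"
      using flow_at_balance by blast
    show "\<forall>(i, j)\<in>edges D. volt_at x i - volt_at x j =
        2 * Re (cnj (impedance D (i, j)) * flow_at x (i, j)) - (cmod (impedance D (i, j)))\<^sup>2 * x (i, j)"
      using volt_at_drop by blast
    show "\<forall>(i, j)\<in>edges D. volt_at x i * x (i, j) = (cmod (flow_at x (i, j)))\<^sup>2"
      using exact by blast
    show "\<forall>e\<in>edges D. 0 \<le> x e \<and> x e \<le> cur y e t \<omega> \<and> Re (flow y e t \<omega>) \<le> Re (flow_at x e) \<and>
        Im (flow y e t \<omega>) \<le> Im (flow_at x e) \<and> cmod (flow_at x e) \<le> cmod (flow y e t \<omega>)"
      using x mag ReS ImS by simp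
    show "\<forall>i\<in>buses D. vsq y i t \<omega> \<le> volt_at x i \<and> (i \<noteq> 0 \<longrightarrow> volt_at x i \<le> v_max D i)"
      using v_ge v_le by simp
  qed
  then show ?thesis by blast
qed

text \<open>The notion refers to the scenario only through variables of \<open>y\<close> at time \<open>t\<close>. The demand
  enters only through the bus injections, which are themselves non-anticipative.\<close>

lemma exact_improvement_cong:
  assumes D: "radial_connected D" and y: "nonanticipative D y"
    and t: "t \<in> steps D" and w: "\<omega> \<in> scenarios D" "\<omega>' \<in> scenarios D"
    and ind: "indistinguishable D t \<omega> \<omega>'"
    and imp: "exact_improvement D y t \<omega>' p"
  shows "exact_improvement D y t \<omega> p"
proof -
  have na: "s0 y t \<omega> = s0 y t \<omega>'" "\<And>i. i \<in> buses D - {0} \<Longrightarrow> sinj y i t \<omega> = sinj y i t \<omega>'"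
    "\<And>e. e \<in> edges D \<Longrightarrow> flow y e t \<omega> = flow y e t \<omega>' \<and> cur y e t \<omega> = cur y e t \<omega>'"
    "\<And>i. i \<in> buses D \<Longrightarrow> vsq y i t \<omega> = vsq y i t \<omega>'"
    using y[unfolded nonanticipative_def] t w ind by blast+
  have bal: "(\<forall>(i, j)\<in>edges D. S (i, j) = R i + sinj y i t \<omega>) =
      (\<forall>(i, j)\<in>edges D. S (i, j) = R i + sinj y i t \<omega>')" for S :: "edge \<Rightarrow> complex" and R
    using na(2) edge_source[OF D] by (intro ball_cong) auto
  obtain a S c v where p: "p = (a, S, c, v)" by (cases p)
  show ?thesis
    using imp unfolding p exact_improvement_def case_prod_conv bal[of S] na(1)
    by (simp only: na(3,4) cong: ball_cong) blast
qed

text \<open>The local improvements are assembled into one point. Outside the index sets it copies \<open>y\<close>,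
  so that the two points differ in finitely many components of each scenario, as the comparison of
  costs requires.\<close>

lemma exact_improvement_feasible:
  assumes data: "opf_data D" and D: "radial_connected D" and cost: "monotone_cost D C"
    and y: "base_feasible D y"
    and ex: "\<And>t \<omega>. t \<in> steps D \<Longrightarrow> \<omega> \<in> scenarios D \<Longrightarrow> \<exists>p. exact_improvement D y t \<omega> p"
  obtains y' where "base_feasible D y'" "nonconvex_constraint D y'"
    "expected_cost D C y' \<le> expected_cost D C y"
proof -
  define rep where "rep t \<omega> = (SOME \<omega>'. \<omega>' \<in> scenarios D \<and> indistinguishable D t \<omega> \<omega>')" for t \<omega>
  have rep: "rep t \<omega> \<in> scenarios D \<and> indistinguishable D t \<omega> (rep t \<omega>)" if "\<omega> \<in> scenarios D" for t \<omega>
    unfolding rep_def by (rule someI[of _ \<omega>]) (use that in \<open>auto simp: indistinguishable_def\<close>)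
  have rep_eq: "rep t \<omega> = rep t \<omega>'" if "indistinguishable D t \<omega> \<omega>'" for t \<omega> \<omega>'
  proof -
    have "indistinguishable D t \<omega> = indistinguishable D t \<omega>'"
      using that unfolding indistinguishable_def fun_eq_iff by metis
    then show ?thesis by (simp only: rep_def)
  qed
  have na: "nonanticipative D y" using y by (simp add: base_feasible_def)
  define P where "P t \<omega> = (SOME p. exact_improvement D y t (rep t \<omega>) p)" for t \<omega>
  define a S c v where "a t \<omega> = fst (P t \<omega>)" and "S t \<omega> = fst (snd (P t \<omega>))"
    and "c t \<omega> = fst (snd (snd (P t \<omega>)))" and "v t \<omega> = snd (snd (snd (P t \<omega>)))" for t \<omega>
  have P_eq: "P t \<omega> = P t \<omega>'" if "indistinguishable D t \<omega> \<omega>'" for t \<omega> \<omega>'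
    using rep_eq[OF that] by (simp add: P_def)
  have imp: "exact_improvement D y t \<omega> (a t \<omega>, S t \<omega>, c t \<omega>, v t \<omega>)"
    if t: "t \<in> steps D" and w: "\<omega> \<in> scenarios D" for t \<omega>
  proof -
    have "exact_improvement D y t (rep t \<omega>) (P t \<omega>)"
      unfolding P_def by (rule someI_ex[OF ex[OF t]]) (use rep[OF w] in blast)
    then have "exact_improvement D y t \<omega> (P t \<omega>)"
      using exact_improvement_cong[OF D na t w] rep[OF w] by blast
    then show ?thesis by (simp add: a_def S_def c_def v_def)
  qed
  note imp = imp[unfolded exact_improvement_def case_prod_conv]
  have imp_a: "Re (a t \<omega>) \<le> Re (s0 y t \<omega>) \<and> Im (a t \<omega>) \<le> Im (s0 y t \<omega>)"
    and imp_v0: "v t \<omega> 0 = 1"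
    and imp_root: "0 = (\<Sum>k | (k, 0) \<in> edges D.
      S t \<omega> (k, 0) - impedance D (k, 0) * complex_of_real (c t \<omega> (k, 0))) + a t \<omega>"
    if "t \<in> steps D" "\<omega> \<in> scenarios D" for t \<omega>
    using imp[OF that] by blast+
  have imp_e: "0 \<le> c t \<omega> e \<and> c t \<omega> e \<le> cur y e t \<omega> \<and> Re (flow y e t \<omega>) \<le> Re (S t \<omega> e) \<and>
      Im (flow y e t \<omega>) \<le> Im (S t \<omega> e) \<and> cmod (S t \<omega> e) \<le> cmod (flow y e t \<omega>)"
    if "t \<in> steps D" "\<omega> \<in> scenarios D" "e \<in> edges D" for t \<omega> e
    using imp[OF that(1,2)] that(3) by blast
  have imp_v: "vsq y i t \<omega> \<le> v t \<omega> i" "i \<noteq> 0 \<Longrightarrow> v t \<omega> i \<le> v_max D i"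
    if "t \<in> steps D" "\<omega> \<in> scenarios D" "i \<in> buses D" for t \<omega> i
    using imp[OF that(1,2)] that(3) by blast+
  have imp_eq: "S t \<omega> (i, j) = (\<Sum>k | (k, i) \<in> edges D.
        S t \<omega> (k, i) - impedance D (k, i) * complex_of_real (c t \<omega> (k, i))) + sinj y i t \<omega>"
      "v t \<omega> i - v t \<omega> j = 2 * Re (cnj (impedance D (i, j)) * S t \<omega> (i, j))
        - (cmod (impedance D (i, j)))\<^sup>2 * c t \<omega> (i, j)"
      "v t \<omega> i * c t \<omega> (i, j) = (cmod (S t \<omega> (i, j)))\<^sup>2"
    if "t \<in> steps D" "\<omega> \<in> scenarios D" "(i, j) \<in> edges D" for t \<omega> i j
    using imp[OF that(1,2)] that(3) by blast+
  define y' where "y' = y\<lparr>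
     s0 := (\<lambda>t \<omega>. if t \<in> steps D then a t \<omega> else s0 y t \<omega>),
     flow := (\<lambda>e t \<omega>. if e \<in> edges D \<and> t \<in> steps D then S t \<omega> e else flow y e t \<omega>),
     cur := (\<lambda>e t \<omega>. if e \<in> edges D \<and> t \<in> steps D then c t \<omega> e else cur y e t \<omega>),
     vsq := (\<lambda>i t \<omega>. if i \<in> buses D \<and> t \<in> steps D then v t \<omega> i else vsq y i t \<omega>)\<rparr>"
  have y'_sel: "sinj y' = sinj y" "pinj y' = pinj y" "pabs y' = pabs y" "qinj y' = qinj y" "soc y' = soc y"
    "\<And>t \<omega>. s0 y' t \<omega> = (if t \<in> steps D then a t \<omega> else s0 y t \<omega>)"
    "\<And>e t \<omega>. flow y' e t \<omega> = (if e \<in> edges D \<and> t \<in> steps D then S t \<omega> e else flow y e t \<omega>)"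
    "\<And>e t \<omega>. cur y' e t \<omega> = (if e \<in> edges D \<and> t \<in> steps D then c t \<omega> e else cur y e t \<omega>)"
    "\<And>i t \<omega>. vsq y' i t \<omega> = (if i \<in> buses D \<and> t \<in> steps D then v t \<omega> i else vsq y i t \<omega>)"
    by (simp_all add: y'_def)
  have ends: "i \<in> buses D" "j \<in> buses D" if "(i, j) \<in> edges D" for i j
    using that D by (auto simp: radial_connected_def)
  have zero: "0 \<in> buses D" by (simp add: buses_def)
  have feas: "bound_constraints D y' t \<omega> \<and> storage_constraints D y' t \<omega> \<and> flow_constraints D y' t \<omega>"
    if t: "t \<in> steps D" and w: "\<omega> \<in> scenarios D" for t \<omega>
  proof (intro conjI)
    have old: "bound_constraints D y t \<omega>" "storage_constraints D y t \<omega>" "flow_constraints D y t \<omega>"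
      using y t w by (auto simp: base_feasible_def)
    show "bound_constraints D y' t \<omega>"
      unfolding bound_constraints_def
    proof (intro conjI ballI)
      show "vsq y' 0 t \<omega> = 1" using imp_v0[OF t w] t zero by (simp add: y'_sel)
    next
      fix i assume i: "i \<in> buses D - {0}"
      have "v_min D i \<le> vsq y i t \<omega>" using old(1) i unfolding bound_constraints_def by blast
      then show "v_min D i \<le> vsq y' i t \<omega>" "vsq y' i t \<omega> \<le> v_max D i"
        using imp_v[OF t w, of i] i t by (auto simp: y'_sel)
    next
      fix e assume e: "e \<in> edges D"
      have "cur y e t \<omega> \<le> cur_max D e" "cmod (flow y e t \<omega>) \<le> flow_max D e"
        using old(1) e unfolding bound_constraints_def by blast+
      then show "0 \<le> cur y' e t \<omega>" "cur y' e t \<omega> \<le> cur_max D e" "cmod (flow y' e t \<omega>) \<le> flow_max D e"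
        using imp_e[OF t w e] e t by (simp_all add: y'_sel)
    qed (use old(1) in \<open>simp_all add: bound_constraints_def y'_sel\<close>)
    show "storage_constraints D y' t \<omega>"
      using old(2) unfolding storage_constraints_def y'_sel .
    show "flow_constraints D y' t \<omega>"
      unfolding flow_constraints_def
    proof (intro conjI)
      show "\<forall>i\<in>buses D - {0}. sinj y' i t \<omega> =
         complex_of_real (pinj y' i t \<omega>) - complex_of_real (pabs y' i t \<omega>)
         + \<i> * complex_of_real (qinj y' i t \<omega>) - demand D i t \<omega>"
        using old(3) unfolding flow_constraints_def y'_sel by blast
      show "0 = (\<Sum>k | (k, 0) \<in> edges D. flow y' (k, 0) t \<omega>
          - impedance D (k, 0) * complex_of_real (cur y' (k, 0) t \<omega>)) + s0 y' t \<omega>"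
        using imp_root[OF t w] t by (simp add: y'_sel)
      show "\<forall>(i, j)\<in>edges D. flow y' (i, j) t \<omega> = (\<Sum>k | (k, i) \<in> edges D. flow y' (k, i) t \<omega>
          - impedance D (k, i) * complex_of_real (cur y' (k, i) t \<omega>)) + sinj y' i t \<omega>"
      proof (intro ballI, unfold case_prod_unfold, goal_cases)
        case (1 e)
        then show ?case using imp_eq(1)[OF t w, of "fst e" "snd e"] t by (simp add: y'_sel)
      qed
      show "\<forall>(i, j)\<in>edges D. vsq y' i t \<omega> - vsq y' j t \<omega> =
          2 * Re (cnj (impedance D (i, j)) * flow y' (i, j) t \<omega>)
          - (cmod (impedance D (i, j)))\<^sup>2 * cur y' (i, j) t \<omega>"
      proof (intro ballI, unfold case_prod_unfold, goal_cases)
        case (1 e)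
        then show ?case
          using imp_eq(2)[OF t w, of "fst e" "snd e"] ends[of "fst e" "snd e"] t by (simp add: y'_sel)
      qed
    qed
  qed
  have "nonanticipative D y'"
    unfolding nonanticipative_def
  proof (intro ballI impI)
    fix t \<omega> \<omega>'
    assume *: "t \<in> steps D" "\<omega> \<in> scenarios D" "\<omega>' \<in> scenarios D" "indistinguishable D t \<omega> \<omega>'"
    show "s0 y' t \<omega> = s0 y' t \<omega>' \<and>
      (\<forall>i\<in>buses D - {0}. sinj y' i t \<omega> = sinj y' i t \<omega>' \<and> pinj y' i t \<omega> = pinj y' i t \<omega>' \<and>
        pabs y' i t \<omega> = pabs y' i t \<omega>' \<and> qinj y' i t \<omega> = qinj y' i t \<omega>' \<and> soc y' i t \<omega> = soc y' i t \<omega>') \<and>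
      (\<forall>e\<in>edges D. flow y' e t \<omega> = flow y' e t \<omega>' \<and> cur y' e t \<omega> = cur y' e t \<omega>') \<and>
      (\<forall>i\<in>buses D. vsq y' i t \<omega> = vsq y' i t \<omega>')"
      using na[unfolded nonanticipative_def, rule_format, OF *] *(1) P_eq[OF *(4)]
      by (simp add: y'_sel a_def S_def c_def v_def)
  qed
  then have "base_feasible D y'" using feas by (auto simp: base_feasible_def)
  moreover have "nonconvex_constraint D y'"
    unfolding nonconvex_constraint_def
  proof (intro ballI, unfold case_prod_unfold, intro ballI, goal_cases)
    case (1 e t \<omega>)
    then show ?case
      using imp_eq(3)[of t \<omega> "fst e" "snd e"] ends[of "fst e" "snd e"] by (simp add: y'_sel)
  qed
  moreover have "C \<omega> (decision_of y' \<omega>) \<le> C \<omega> (decision_of y \<omega>)" if w: "\<omega> \<in> scenarios D" for \<omega>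
    unfolding decision_of_def y'_sel(1-5)
    by (rule monotone_cost_le[OF cost w finite_edges[OF D]])
      (use imp_a[OF _ w] imp_e[OF _ w] imp_v(1)[OF _ w] in \<open>auto simp: y'_sel\<close>)
  then have "expected_cost D C y' \<le> expected_cost D C y"
    unfolding expected_cost_def using data by (auto simp: opf_data_def intro!: sum_mono mult_left_mono)
  ultimately show ?thesis by (rule that)
qed

theorem theorem3:
  fixes D :: "('w, 'x) opf"
    and C :: "'w \<Rightarrow> decision \<Rightarrow> real"
    and vL :: "bus \<Rightarrow> nat \<Rightarrow> 'w \<Rightarrow> real"
    and SL :: "edge \<Rightarrow> nat \<Rightarrow> 'w \<Rightarrow> complex"
  assumes "opf_data D"
    and "upper_lin_flow D vL SL"
    and "cost_of_decisions D C"
    and "adapted_cost D C"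
    and "radial_connected D"
    and "passive_network D"
    and "convex_cost D C"
    and "monotone_cost D C"
    and "\<forall>i\<in>buses D. \<forall>t\<in>steps D. \<forall>\<omega>\<in>scenarios D. vL i t \<omega> \<le> v_max D i"
    and "\<forall>(i, j)\<in>edges D. \<forall>(k, l)\<in>subtree_edges D i. \<forall>t\<in>steps D. \<forall>\<omega>\<in>scenarios D.
           Re (cnj (impedance D (k, l)) * SL (i, j) t \<omega>) \<le> 0"
  shows "val_P D C = val_SOC D C"
proof (rule antisym)
  show "val_SOC D C \<le> val_P D C"
    unfolding val_SOC_def val_P_def
    by (rule INF_superset_mono) (auto simp: nonconvex_constraint_def soc_constraint_def)
  show "val_P D C \<le> val_SOC D C"
    unfolding val_SOC_def val_P_def
  proof (rule INF_mono)
    fix y assume "y \<in> {y. base_feasible D y \<and> soc_constraint D y}"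
    then have y: "base_feasible D y" "soc_constraint D y" by auto
    obtain y' where "base_feasible D y'" "nonconvex_constraint D y'"
      "expected_cost D C y' \<le> expected_cost D C y"
      using exact_improvement_feasible[OF assms(1,5,8) y(1)]
        exact_improvement_exists[OF assms(1,2,5,6,9,10) y] by metis
    then show "\<exists>y'\<in>{y. base_feasible D y \<and> nonconvex_constraint D y}.
        ereal (expected_cost D C y') \<le> ereal (expected_cost D C y)" by auto
  qed
qed

end
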